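(* Let $p_1<p_2$ be finite real numbers, let $I\subset\mathbb{R}$ be an open interval containing $[p_1,p_2]$, let $\rho>1$ and $\mu\in(0,1]$ be real numbers, and let $p_0\in I\setminus[p_1,p_2]$. Let $\psi:I\to\mathbb{R}$ belong to $\mathcal{C}^2(I)$ and suppose there is a function $\tilde\psi:I\to\mathbb{R}$ such that $\psi'(p)=|p-p_0|^{\rho-1}\,\tilde\psi(p)$ for all $p\in I$, where $|\tilde\psi|:I\to\mathbb{R}$ is continuous and does not vanish on $I$. Let $U:(p_1,p_2]\to\mathbb{C}$ and suppose there is a function $\tilde u:[p_1,p_2]\to\mathbb{C}$, continuous on $[p_1,p_2]$, differentiable on $(p_1,p_2)$ with $\tilde u'\in L^1((p_1,p_2),\mathbb{C})$, and with $\tilde u(p_1)\neq 0$ if $\mu\neq 1$, such that $U(p)=(p-p_1)^{\mu-1}\,\tilde u(p)$ for all $p\in(p_1,p_2]$. Suppose moreover that $\psi'$ is monotone on $[p_1,p_2]$. Then for all $\omega>0$, $$\left|\int_{p_1}^{p_2}U(p)\,e^{i\omega\psi(p)}\,dp\right|\leqslant \tilde C(U,\psi)\,\omega^{-\frac{\mu}{\rho}},$$ where $$\tilde C(U,\psi):=\frac{2}{\mu}\,\|\tilde u\|_{L^\infty(p_1,p_2)}+\Big(4\,\|\tilde u\|_{L^\infty(p_1,p_2)}+\|\tilde u'\|_{L^1(p_1,p_2)}\Big)\Big(\min_{p\in[p_1,p_2]}|\tilde\psi(p)|\Big)^{-1}.$$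
   Context: All notation is standard. The function $\tilde\psi$ itself is not assumed continuous at $p_0$; only $|\tilde\psi|$ is assumed continuous on $I$. *)

theory Defs
  imports "HOL-Analysis.Analysis" "HOL-Probability.Essential_Supremum"
begin

text \<open>For open \<open>I\<close>, the values of \<^term>\<open>deriv f\<close> on \<open>I\<close> depend only on \<open>f\<close> restricted to \<open>I\<close>.\<close>

definition C2_on :: "real set \<Rightarrow> (real \<Rightarrow> real) \<Rightarrow> bool" where
  "C2_on I f \<longleftrightarrow> f C1_differentiable_on I \<and> deriv f C1_differentiable_on I"

text \<open>The \<open>ereal\<close>-valued essential supremum is infinite for functions that are
  unbounded or not measurable; such functions get the junk value 0 here.\<close>

definition Linf_norm :: "real \<Rightarrow> real \<Rightarrow> (real \<Rightarrow> complex) \<Rightarrow> real" where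
  "Linf_norm a b f = real_of_ereal (esssup (lebesgue_on {a<..<b}) (\<lambda>p. ereal (norm (f p))))"

definition L1_norm :: "real \<Rightarrow> real \<Rightarrow> (real \<Rightarrow> complex) \<Rightarrow> real" where
  "L1_norm a b f = (LINT p:{a<..<b}|lebesgue. norm (f p))"

text \<open>\<^const>\<open>Min\<close> is for finite sets; here \<^const>\<open>Least\<close> denotes the minimum
  whenever it is attained, e.g. for continuous \<open>f\<close> and \<open>a \<le> b\<close>.\<close>

definition min_on :: "real \<Rightarrow> real \<Rightarrow> (real \<Rightarrow> real) \<Rightarrow> real" where
  "min_on a b f = (LEAST m. m \<in> f ` {a..b})"

text \<open>The constant depends on \<open>U\<close> and \<open>\<psi>\<close> only through the factors \<open>u\<close> and \<open>g\<close>
  (written with a tilde in the source).\<close>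

definition C_tilde ::
    "real \<Rightarrow> real \<Rightarrow> real \<Rightarrow> (real \<Rightarrow> complex) \<Rightarrow> (real \<Rightarrow> real) \<Rightarrow> real" where
  "C_tilde p\<^sub>1 p\<^sub>2 \<mu> u g =
     2 / \<mu> * Linf_norm p\<^sub>1 p\<^sub>2 u
     + (4 * Linf_norm p\<^sub>1 p\<^sub>2 u + L1_norm p\<^sub>1 p\<^sub>2 (\<lambda>p. vector_derivative u (at p)))
       * inverse (min_on p\<^sub>1 p\<^sub>2 (\<lambda>p. \<bar>g p\<bar>))"

end

theory Submission
  imports Defs
begin

text \<open>Cut \<open>[p\<^sub>1, p\<^sub>2]\<close> at distance \<open>\<delta> = \<omega> powr (- 1 / \<rho>)\<close> from both endpoints. On the two end pieces the
  integrand is dominated by \<open>M (p - p\<^sub>1) powr (\<mu> - 1)\<close>, \<open>M\<close> being the supremum of the regular factor,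
  so each contributes at most \<open>(M / \<mu>) \<delta> powr \<mu>\<close>. Every point of the middle piece has distance at
  least \<open>\<delta>\<close> from \<open>p\<^sub>0\<close>, on whichever side \<open>p\<^sub>0\<close> lies, so the derivative of the phase is at least
  \<open>m \<delta> powr (\<rho> - 1)\<close> in absolute value, where \<open>m\<close> is the minimum in the constant; one integration by
  parts then gives the rest of the bound.\<close>

section \<open>Minimum and essential supremum of continuous functions as pointwise bounds\<close>

lemma
  assumes "continuous_on {a..b} f" and "x \<in> {a..b}"
  shows min_on_in_image: "min_on a b f \<in> f ` {a..b}" and min_on_le: "min_on a b f \<le> f x"
proof -
  obtain y where y: "y \<in> {a..b}" "\<And>z. z \<in> {a..b} \<Longrightarrow> f y \<le> f z"
    using continuous_attains_inf[of "{a..b}" f] assms by auto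
  then have "min_on a b f = f y"
    unfolding min_on_def by (intro Least_equality) auto
  with y assms show "min_on a b f \<in> f ` {a..b}" and "min_on a b f \<le> f x" by auto
qed

text \<open>A single violation would, by continuity, spread to a nonempty open set, and such a set
  is never null. The real threshold \<open>r\<close> strictly between \<open>c\<close> and
  \<open>f x\<close> makes that set a preimage under the real function \<open>f\<close>, whether or
  not \<open>c\<close> is finite.\<close>

lemma AE_lebesgue_on_open_le:
  fixes f :: "real \<Rightarrow> real"
  assumes "open S" and "continuous_on S f"
    and ae: "AE x in lebesgue_on S. ereal (f x) \<le> c" and "x \<in> S"
  shows "ereal (f x) \<le> c"
proof (rule ccontr)
  assume "\<not> ereal (f x) \<le> c"
  then obtain r where r: "c < ereal r" "r < f x"
    using ereal_dense2[of c "ereal (f x)"] by (metis less_ereal.simps(1) not_le)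
  define W where "W = S \<inter> f -` {r<..}"
  have "open W" and "x \<in> W"
    unfolding W_def using continuous_open_preimage[OF assms(2,1), of "{r<..}"] \<open>x \<in> S\<close> r by auto
  have "AE x in lebesgue. x \<in> S \<longrightarrow> ereal (f x) \<le> c"
    using ae \<open>open S\<close> by (subst (asm) AE_restrict_space_iff) auto
  then have "AE x in lebesgue. x \<notin> W"
    by eventually_elim (use r in \<open>auto simp: W_def dest: order.strict_trans1 less_le_trans\<close>)
  then have "W \<in> null_sets lebesgue"
    using \<open>open W\<close> by (subst (asm) AE_iff_null_sets[symmetric]) auto
  then show False
    using open_not_negligible[OF \<open>open W\<close>] \<open>x \<in> W\<close> negligible_iff_null_sets by auto
qed

text \<open>Continuity turns the almost-everywhere bound into one at every interior point, and
  passing to the closure adds the endpoints. Boundedness on the compact interval keeps the essential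
  supremum finite, so \<open>Linf_norm\<close> is not the junk value 0 of
  \<open>real_of_ereal\<close>.\<close>

lemma norm_le_Linf_norm:
  assumes "a < b" and cont: "continuous_on {a..b} f" and "x \<in> {a..b}"
  shows "norm (f x) \<le> Linf_norm a b f"
proof -
  let ?S = "{a<..<b}" and ?e = "esssup (lebesgue_on {a<..<b}) (\<lambda>p. ereal (norm (f p)))"
  have cn: "continuous_on {a..b} (\<lambda>x. norm (f x))"
    using cont by (rule continuous_on_norm)
  have cS: "continuous_on ?S (\<lambda>x. norm (f x))"
    using cn by (rule continuous_on_subset) auto
  obtain B where B: "\<And>x. x \<in> {a..b} \<Longrightarrow> norm (f x) \<le> B"
    using continuous_attains_sup[OF _ _ cn] \<open>a < b\<close> by fastforce
  have le: "ereal (norm (f x)) \<le> ?e" if "x \<in> ?S" for x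
    using AE_lebesgue_on_open_le[OF _ cS esssup_AE that] by simp
  have "(\<lambda>x. norm (f x)) \<in> borel_measurable (lebesgue_on ?S)"
    using cS by (rule continuous_imp_measurable_on_sets_lebesgue) auto
  then have "?e \<le> ereal B"
    by (intro esssup_I borel_measurable_ereal AE_I2) (auto simp: B)
  moreover have "0 \<le> ?e"
    using le[of "(a+b)/2"] \<open>a < b\<close> by (auto intro: order_trans[of _ "ereal (norm (f ((a+b)/2)))"])
  ultimately have "?e = ereal (Linf_norm a b f)"
    unfolding Linf_norm_def by (cases ?e) auto
  with le have "norm (f x) \<le> Linf_norm a b f" if "x \<in> ?S" for x
    using that by force
  then show ?thesis
    using continuous_le_on_closure[of ?S "\<lambda>x. norm (f x)" x] cn \<open>a < b\<close> \<open>x \<in> {a..b}\<close> by auto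
qed

section \<open>Integrals and subadditivity of real powers\<close>

text \<open>The integrand is unbounded near \<open>p\<close> when \<open>a = p\<close> and \<mu> <
  1, but the antiderivative stays continuous there. Hence the form of the fundamental theorem that
  asks for a derivative only in the open interval.\<close>

lemma has_integral_shifted_powr:
  fixes \<mu> :: real
  assumes "0 < \<mu>" and "p \<le> a" and "a \<le> b"
  shows "((\<lambda>x. (x - p) powr (\<mu> - 1)) has_integral ((b - p) powr \<mu> / \<mu> - (a - p) powr \<mu> / \<mu>)) {a..b}"
proof (rule fundamental_theorem_of_calculus_interior)
  show "continuous_on {a..b} (\<lambda>x. (x - p) powr \<mu> / \<mu>)"
    using assms by (intro continuous_intros continuous_on_powr') auto
  show "((\<lambda>x. (x - p) powr \<mu> / \<mu>) has_vector_derivative (x - p) powr (\<mu> - 1)) (at x)"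
    if "x \<in> {a<..<b}" for x
    unfolding has_real_derivative_iff_has_vector_derivative[symmetric]
    using that assms by (auto intro!: derivative_eq_intros)
qed fact

text \<open>The fractions \<open>x / (x + y)\<close> and \<open>y / (x + y)\<close> lie in [0, 1],
  where raising to a power \<mu> \<le> 1 does not decrease a number, and they add up to 1. It bounds
  the growth of the \<mu>-th power over a step of length \<delta> by
  \<open>\<delta> powr \<mu>\<close>, wherever the step starts.\<close>

lemma powr_add_le_add_powr:
  fixes x y \<mu> :: real
  assumes "0 \<le> x" "0 \<le> y" "0 < \<mu>" "\<mu> \<le> 1"
  shows "(x + y) powr \<mu> \<le> x powr \<mu> + y powr \<mu>"
proof (cases "x + y = 0")
  case False
  have sub: "t / (x + y) \<le> (t / (x + y)) powr \<mu>" if "0 \<le> t" "t \<le> x + y" for t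
    using that assms False powr_mono'[of \<mu> 1 "t / (x + y)"] by (cases "t = 0") auto
  have "1 = x / (x + y) + y / (x + y)"
    using False by (simp add: add_divide_distrib[symmetric])
  also have "\<dots> \<le> (x powr \<mu> + y powr \<mu>) / (x + y) powr \<mu>"
    using sub[of x] sub[of y] assms by (simp add: powr_divide add_divide_distrib)
  finally show ?thesis
    using False assms by (simp add: field_simps)
qed (use assms in auto)

section \<open>Oscillatory integrals without stationary points\<close>

text \<open>Integration by parts moves the derivative from the exponential onto
  \<open>F / d\<close>. The sign \<open>s\<close> treats increasing and decreasing \<open>d\<close>
  together: as \<open>d'\<close> keeps its sign, the integral of
  \<open>\<bar>d'\<bar> / d\<^sup>2\<close> telescopes to a difference of values of
  \<open>1 / d\<close>. The majorant \<open>h\<close> lets the caller choose a function whose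
  integral is easy to bound.\<close>

lemma first_derivative_test:
  fixes F F' :: "real \<Rightarrow> complex" and \<psi> d d' h :: "real \<Rightarrow> real"
  assumes "a \<le> b" and "0 < K" and "0 < \<omega>"
    and \<psi>: "\<And>x. x \<in> {a..b} \<Longrightarrow> (\<psi> has_real_derivative d x) (at x)"
    and d: "\<And>x. x \<in> {a..b} \<Longrightarrow> (d has_real_derivative d' x) (at x)"
    and F: "\<And>x. x \<in> {a..b} \<Longrightarrow> (F has_vector_derivative F' x) (at x)"
    and K: "\<And>x. x \<in> {a..b} \<Longrightarrow> K \<le> \<bar>d x\<bar>"
    and sgn: "\<bar>s\<bar> = 1" "\<And>x. x \<in> {a..b} \<Longrightarrow> 0 \<le> s * d' x"
    and A: "\<And>x. x \<in> {a..b} \<Longrightarrow> norm (F x) \<le> A"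
    and h: "\<And>x. x \<in> {a..b} \<Longrightarrow> norm (F' x) \<le> h x" "h integrable_on {a..b}"
  shows "norm (integral {a..b} (\<lambda>x. F x * exp (\<i> * of_real (\<omega> * \<psi> x))))
          \<le> (norm (F a) + norm (F b) + integral {a..b} h + 2 * A) / (\<omega> * K)"
proof -
  define E where "E x = exp (\<i> * of_real (\<omega> * \<psi> x))" for x
  \<comment> \<open>\<open>G' = \<i> \<omega> F E + R\<close>, so \<omega> times the integral of
    \<open>F E\<close> is controlled by the boundary values of \<open>G\<close> and the integral of
    \<open>R\<close>.\<close>
  define G where "G x = F x * of_real (1 / d x) * E x" for x
  define R where "R x = (F' x * of_real (1 / d x) - F x * of_real (d' x / (d x)\<^sup>2)) * E x" for x
  have nE: "norm (E x) = 1" for x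
    by (simp add: E_def)
  have "0 \<le> A"
    using order_trans[OF norm_ge_zero A[of a]] \<open>a \<le> b\<close> by simp
  have dnz: "d x \<noteq> 0" if "x \<in> {a..b}" for x
    using K[OF that] \<open>0 < K\<close> by auto
  have E': "(E has_vector_derivative \<i> * of_real (\<omega> * d x) * E x) (at x)" if "x \<in> {a..b}" for x
  proof -
    have "((\<lambda>x. \<i> * of_real (\<omega> * \<psi> x)) has_vector_derivative \<i> * of_real (\<omega> * d x)) (at x)"
      by (intro has_vector_derivative_mult_right has_vector_derivative_of_real)
        (use \<psi>[OF that] in \<open>auto intro!: derivative_eq_intros\<close>)
    from field_vector_diff_chain_at[OF this DERIV_exp] show ?thesis
      by (simp add: E_def[abs_def] o_def)
  qed
  have inv: "((\<lambda>x. 1 / d x) has_real_derivative - (d' x / (d x)\<^sup>2)) (at x)" if "x \<in> {a..b}" for x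
    using d[OF that] dnz[OF that] by (auto intro!: derivative_eq_intros simp: power2_eq_square)
  have "(G has_vector_derivative \<i> * of_real \<omega> * (F x * E x) + R x) (at x)" if "x \<in> {a..b}" for x
  proof -
    have "((\<lambda>x. complex_of_real (1 / d x)) has_vector_derivative of_real (- (d' x / (d x)\<^sup>2))) (at x)"
      using inv[OF that] by (rule has_vector_derivative_of_real)
    from has_vector_derivative_mult[OF has_vector_derivative_mult[OF F[OF that] this] E'[OF that]]
    show ?thesis
      unfolding G_def[abs_def] R_def
      by (rule has_vector_derivative_eq_rhs) (use dnz[OF that] in \<open>simp add: field_simps\<close>)
  qed
  then have int: "((\<lambda>x. \<i> * of_real \<omega> * (F x * E x) + R x) has_integral (G b - G a)) {a..b}"
    using \<open>a \<le> b\<close> by (intro fundamental_theorem_of_calculus) (auto intro: has_vector_derivative_at_within)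
  have "continuous_on {a..b} F" "continuous_on {a..b} E"
    using F E' by (meson continuous_at_imp_continuous_on has_vector_derivative_continuous)+
  then have FE: "(\<lambda>x. F x * E x) integrable_on {a..b}"
    by (intro integrable_continuous_interval continuous_intros)
  then have int_FE: "((\<lambda>x. \<i> * of_real \<omega> * (F x * E x))
      has_integral (\<i> * of_real \<omega> * integral {a..b} (\<lambda>x. F x * E x))) {a..b}"
    by (intro has_integral_mult_right integrable_integral)
  \<comment> \<open>\<open>F'\<close> and \<open>d'\<close> are not assumed continuous, so
    integrability of \<open>R\<close> is obtained as that of a difference: the derivative of
    \<open>G\<close> minus a continuous function.\<close>
  from has_integral_diff[OF int int_FE]
  have R: "(R has_integral (G b - G a - \<i> * of_real \<omega> * integral {a..b} (\<lambda>x. F x * E x))) {a..b}"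
    by simp
  \<comment> \<open>Writing \<open>s * d'\<close> for \<open>\<bar>d'\<bar>\<close> makes the second
    summand an exact derivative.\<close>
  let ?g = "\<lambda>x. h x / K + A * (s * (d' x / (d x)\<^sup>2))"
  have int_d: "((\<lambda>x. d' x / (d x)\<^sup>2) has_integral - (1 / d b) - - (1 / d a)) {a..b}"
  proof (rule fundamental_theorem_of_calculus[OF \<open>a \<le> b\<close>])
    fix x assume "x \<in> {a..b}"
    from DERIV_minus[OF inv[OF this]]
    show "((\<lambda>x. - (1 / d x)) has_vector_derivative d' x / (d x)\<^sup>2) (at x within {a..b})"
      by (simp add: has_real_derivative_iff_has_vector_derivative has_vector_derivative_at_within)
  qed
  have g: "(?g has_integral
      (integral {a..b} h / K + A * (s * (- (1 / d b) - - (1 / d a))))) {a..b}"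
    by (intro has_integral_add has_integral_divide has_integral_mult_right integrable_integral h int_d)
  have "norm (R x) \<le> ?g x" if "x \<in> {a..b}" for x
  proof -
    have "norm (R x) \<le> norm (F' x) * (1 / \<bar>d x\<bar>) + norm (F x) * (\<bar>d' x\<bar> / (d x)\<^sup>2)"
      unfolding R_def norm_mult nE
      by (rule order_trans[OF mult_right_mono[OF norm_triangle_ineq4]])
        (auto simp: norm_mult norm_divide norm_power)
    also have "\<dots> \<le> h x * (1 / K) + A * (\<bar>d' x\<bar> / (d x)\<^sup>2)"
      using K[OF that] \<open>0 < K\<close> h(1)[OF that] A[OF that] order_trans[OF norm_ge_zero h(1)[OF that]] \<open>0 \<le> A\<close>
      by (intro add_mono mult_mono divide_left_mono) auto
    also have "\<bar>d' x\<bar> = s * d' x"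
      using sgn(2)[OF that] sgn(1) by (metis abs_mult abs_of_nonneg mult_1)
    finally show ?thesis by simp
  qed
  then have "norm (integral {a..b} R) \<le> integral {a..b} ?g"
    using R g by (intro integral_norm_bound_integral) (auto simp: has_integral_integrable)
  also have "\<dots> = integral {a..b} h / K + A * (s * (1 / d a - 1 / d b))"
    using g by (simp add: integral_unique)
  also have "\<dots> \<le> integral {a..b} h / K + A * (2 / K)"
  proof -
    have "\<bar>1 / d x\<bar> \<le> 1 / K" if "x \<in> {a..b}" for x
      using K[OF that] \<open>0 < K\<close> by (auto simp: divide_simps)
    then have "\<bar>1 / d a\<bar> \<le> 1 / K" and "\<bar>1 / d b\<bar> \<le> 1 / K"
      using \<open>a \<le> b\<close> by auto
    then have "\<bar>1 / d a - 1 / d b\<bar> \<le> 2 / K"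
      by linarith
    then have "s * (1 / d a - 1 / d b) \<le> 2 / K"
      using abs_ge_self[of "s * (1 / d a - 1 / d b)"] sgn(1) by (simp add: abs_mult)
    then show ?thesis
      using \<open>0 \<le> A\<close> by (intro add_left_mono mult_left_mono)
  qed
  finally have bR: "norm (integral {a..b} R) \<le> integral {a..b} h / K + A * (2 / K)" .
  have bG: "norm (G x) \<le> norm (F x) / K" if "x \<in> {a..b}" for x
    using K[OF that] \<open>0 < K\<close> unfolding G_def norm_mult nE
    by (auto simp: norm_divide intro!: divide_left_mono)
  have "\<omega> * norm (integral {a..b} (\<lambda>x. F x * E x)) = norm (G b - G a - integral {a..b} R)"
    using R \<open>0 < \<omega>\<close> by (simp add: integral_unique norm_mult)
  also have "\<dots> \<le> norm (G b) + norm (G a) + norm (integral {a..b} R)"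
    by (meson add_mono norm_triangle_ineq4 order_trans order_refl)
  also have "\<dots> \<le> norm (F b) / K + norm (F a) / K + (integral {a..b} h / K + A * (2 / K))"
    using \<open>a \<le> b\<close> by (intro add_mono bG bR) auto
  also have "\<dots> = (norm (F a) + norm (F b) + integral {a..b} h + 2 * A) / K"
    using \<open>0 < K\<close> by (simp add: field_simps)
  finally show ?thesis
    using \<open>0 < \<omega>\<close> \<open>0 < K\<close> by (simp add: E_def field_simps)
qed

section \<open>The uniform estimate for the oscillatory integral\<close>

theorem theorem1p6:
  fixes p\<^sub>0 p\<^sub>1 p\<^sub>2 \<rho> \<mu> :: real
    and I :: "real set"
    and \<psi> \<psi>t :: "real \<Rightarrow> real"
    and U ut :: "real \<Rightarrow> complex"
  assumes "p\<^sub>1 < p\<^sub>2"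
    and "open I" and "is_interval I" and "{p\<^sub>1..p\<^sub>2} \<subseteq> I"
    and "1 < \<rho>" and "0 < \<mu>" and "\<mu> \<le> 1"
    and "p\<^sub>0 \<in> I - {p\<^sub>1..p\<^sub>2}"
    and "C2_on I \<psi>"
    and "\<And>p. p \<in> I \<Longrightarrow> deriv \<psi> p = \<bar>p - p\<^sub>0\<bar> powr (\<rho> - 1) * \<psi>t p"
    and "continuous_on I (\<lambda>p. \<bar>\<psi>t p\<bar>)"
    and "\<And>p. p \<in> I \<Longrightarrow> \<bar>\<psi>t p\<bar> \<noteq> 0"
    and "continuous_on {p\<^sub>1..p\<^sub>2} ut"
    and "\<And>p. p \<in> {p\<^sub>1<..<p\<^sub>2} \<Longrightarrow> ut differentiable (at p)"
    and "(\<lambda>p. vector_derivative ut (at p)) absolutely_integrable_on {p\<^sub>1<..<p\<^sub>2}"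
    and "\<mu> \<noteq> 1 \<Longrightarrow> ut p\<^sub>1 \<noteq> 0"
    and "\<And>p. p \<in> {p\<^sub>1<..p\<^sub>2} \<Longrightarrow> U p = of_real ((p - p\<^sub>1) powr (\<mu> - 1)) * ut p"
    and "mono_on {p\<^sub>1..p\<^sub>2} (deriv \<psi>) \<or> antimono_on {p\<^sub>1..p\<^sub>2} (deriv \<psi>)"
  shows "\<forall>\<omega>>0. norm (LINT p:{p\<^sub>1<..p\<^sub>2}|lebesgue. U p * exp (\<i> * of_real (\<omega> * \<psi> p)))
           \<le> C_tilde p\<^sub>1 p\<^sub>2 \<mu> ut \<psi>t * \<omega> powr (- (\<mu> / \<rho>))"
proof (intro allI impI)
  fix \<omega> :: real
  assume "0 < \<omega>"
  note lt = assms(1) and I_sub = assms(4) and \<rho> = assms(5) and \<mu> = assms(6,7) and p0 = assms(8)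
    and \<psi>' = assms(10) and ut = assms(13)
  define M where "M = Linf_norm p\<^sub>1 p\<^sub>2 ut"
  define V where "V = L1_norm p\<^sub>1 p\<^sub>2 (\<lambda>p. vector_derivative ut (at p))"
  define m where "m = min_on p\<^sub>1 p\<^sub>2 (\<lambda>p. \<bar>\<psi>t p\<bar>)"
  \<comment> \<open>This choice gives \<open>\<omega> * \<delta> powr \<rho> = 1\<close>. It
    balances the end pieces, of order \<open>\<delta> powr \<mu>\<close>, against the middle one, of
    order \<open>\<delta> powr (\<mu> - 1) / (\<omega> * \<delta> powr (\<rho> -
    1))\<close>.\<close>
  define \<delta> where "\<delta> = \<omega> powr (- (1 / \<rho>))"
  define E where "E p = exp (\<i> * of_real (\<omega> * \<psi> p))" for p
  \<comment> \<open>\<open>F\<close> extends \<open>U\<close> to the left endpoint with value 0,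
    since \<open>0 powr x = 0\<close>; one point does not affect the integral.\<close>
  define F where "F p = of_real ((p - p\<^sub>1) powr (\<mu> - 1)) * ut p" for p
  have M: "norm (ut p) \<le> M" if "p \<in> {p\<^sub>1..p\<^sub>2}" for p
    unfolding M_def using lt ut that by (rule norm_le_Linf_norm)
  have "0 \<le> M"
    using order_trans[OF norm_ge_zero M[of p\<^sub>1]] lt by simp
  have cont_abs: "continuous_on {p\<^sub>1..p\<^sub>2} (\<lambda>p. \<bar>\<psi>t p\<bar>)"
    using assms(11) I_sub by (rule continuous_on_subset)
  have m: "m \<le> \<bar>\<psi>t p\<bar>" if "p \<in> {p\<^sub>1..p\<^sub>2}" for p
    unfolding m_def using min_on_le[OF cont_abs that] .
  have "0 < m"
    unfolding m_def using min_on_in_image[OF cont_abs, of p\<^sub>1] lt assms(12) I_sub by fastforce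
  have "0 < \<delta>"
    unfolding \<delta>_def using \<open>0 < \<omega>\<close> by simp
  have \<delta>_\<mu>: "\<delta> powr \<mu> = \<omega> powr (- (\<mu> / \<rho>))"
    unfolding \<delta>_def by (simp add: powr_powr)
  have "\<delta> powr \<rho> = \<omega> powr (- 1)"
    unfolding \<delta>_def powr_powr using \<rho> by simp
  then have \<omega>_\<delta>: "\<omega> * \<delta> powr \<rho> = 1"
    using \<open>0 < \<omega>\<close> by (simp add: powr_minus)

  obtain D2 where D2: "\<And>x. x \<in> I \<Longrightarrow> (deriv \<psi> has_real_derivative D2 x) (at x)"
    using assms(9) unfolding C2_on_def C1_differentiable_on_def
      has_real_derivative_iff_has_vector_derivative by blast
  have D1: "(\<psi> has_real_derivative deriv \<psi> x) (at x)" if "x \<in> I" for x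
    using assms(9) that unfolding C2_on_def C1_differentiable_on_def
      has_real_derivative_iff_has_vector_derivative[symmetric] by (metis DERIV_imp_deriv)
  \<comment> \<open>Monotonicity on the closed interval fixes the sign of the second derivative only
    at interior points, which suffices because the middle piece stays away from both
    endpoints.\<close>
  obtain s :: real where s: "\<bar>s\<bar> = 1" "\<And>x. x \<in> {p\<^sub>1<..<p\<^sub>2} \<Longrightarrow> 0 \<le> s * D2 x"
  proof (cases "mono_on {p\<^sub>1..p\<^sub>2} (deriv \<psi>)")
    case True
    have "0 \<le> 1 * D2 x" if "x \<in> {p\<^sub>1<..<p\<^sub>2}" for x
      using mono_on_imp_deriv_nonneg[OF True D2] that I_sub by (simp add: subset_eq)
    then show ?thesis using that[of 1] by simp
  next
    case False
    then have neg: "mono_on {p\<^sub>1..p\<^sub>2} (\<lambda>x. - deriv \<psi> x)"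
      using assms(18) by (auto simp: monotone_on_def)
    have "0 \<le> -1 * D2 x" if "x \<in> {p\<^sub>1<..<p\<^sub>2}" for x
      using mono_on_imp_deriv_nonneg[OF neg DERIV_minus[OF D2]] that I_sub by (simp add: subset_eq)
    then show ?thesis using that[of "-1"] by simp
  qed

  have powr_int: "(\<lambda>p. (p - p\<^sub>1) powr (\<mu> - 1)) absolutely_integrable_on {p\<^sub>1..p\<^sub>2}"
    using has_integral_shifted_powr[OF \<mu>(1) order_refl less_imp_le[OF lt]]
    by (intro nonnegative_absolutely_integrable_1) auto
  have "continuous_on {p\<^sub>1..p\<^sub>2} \<psi>"
    using D1 I_sub by (meson DERIV_isCont continuous_at_imp_continuous_on subsetD)
  then have contE: "continuous_on {p\<^sub>1..p\<^sub>2} E"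
    unfolding E_def by (intro continuous_intros)
  \<comment> \<open>The singular power is integrable, and the remaining factor
    \<open>ut p * E p\<close> is continuous on a compact interval, hence bounded and
    measurable.\<close>
  have FE_abs: "(\<lambda>p. F p * E p) absolutely_integrable_on {p\<^sub>1..p\<^sub>2}"
  proof -
    have c: "continuous_on {p\<^sub>1..p\<^sub>2} (\<lambda>p. ut p * E p)"
      by (intro continuous_intros ut contE)
    have "bilinear (\<lambda>(z::complex) (r::real). r *\<^sub>R z)"
      by (simp add: bilinear_conv_bounded_bilinear bounded_bilinear.flip[OF bounded_bilinear_scaleR])
    from absolutely_integrable_bounded_measurable_product[OF this
        continuous_imp_measurable_on_sets_lebesgue[OF c] _
        compact_imp_bounded[OF compact_continuous_image[OF c]] powr_int]
    show ?thesis
      by (simp add: F_def scaleR_conv_of_real mult.assoc)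
  qed
  have FE_int: "(\<lambda>p. F p * E p) integrable_on {a..b}" if "p\<^sub>1 \<le> a" "b \<le> p\<^sub>2" for a b
    using absolutely_integrable_on_subinterval[OF FE_abs, of a b] that
    by (auto simp: absolutely_integrable_on_def)
  have nF: "norm (F p) \<le> M * (p - p\<^sub>1) powr (\<mu> - 1)" if "p \<in> {p\<^sub>1..p\<^sub>2}" for p
    unfolding F_def norm_mult using M[OF that] by (simp add: mult.commute[of M] mult_left_mono)

  \<comment> \<open>Here the oscillation is ignored: \<open>E\<close> has modulus 1, and the
    majorant of \<open>F\<close> is integrated exactly.\<close>
  have trivial: "norm (integral {a..b} (\<lambda>p. F p * E p))
      \<le> M / \<mu> * ((b - p\<^sub>1) powr \<mu> - (a - p\<^sub>1) powr \<mu>)"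
    if "p\<^sub>1 \<le> a" "a \<le> b" "b \<le> p\<^sub>2" for a b
  proof -
    note I = has_integral_mult_right[OF has_integral_shifted_powr[OF \<mu>(1) that(1,2)], of M]
    have "norm (integral {a..b} (\<lambda>p. F p * E p)) \<le> integral {a..b} (\<lambda>p. M * (p - p\<^sub>1) powr (\<mu> - 1))"
      using FE_int that I nF
      by (intro integral_norm_bound_integral) (auto simp: norm_mult E_def has_integral_integrable)
    also have "\<dots> = M / \<mu> * ((b - p\<^sub>1) powr \<mu> - (a - p\<^sub>1) powr \<mu>)"
      using integral_unique[OF I] by (simp add: diff_divide_distrib[symmetric])
    finally show ?thesis .
  qed

  have "norm (integral {p\<^sub>1..p\<^sub>2} (\<lambda>p. F p * E p)) \<le> (2 / \<mu> * M + (4 * M + V) * inverse m) * \<delta> powr \<mu>"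
  \<comment> \<open>If the interval has length at most 2 \<delta>, no middle piece is left, and the
    bound without oscillation on the whole interval already yields the term with
    \<open>2 / \<mu>\<close>.\<close>
  proof (cases "2 * \<delta> < p\<^sub>2 - p\<^sub>1")
    case False
    have "0 \<le> V"
      unfolding V_def L1_norm_def set_lebesgue_integral_def by simp
    have "(p\<^sub>2 - p\<^sub>1) powr \<mu> \<le> (\<delta> + \<delta>) powr \<mu>"
      using False lt \<mu> by (intro powr_mono2) auto
    also have "\<dots> \<le> 2 * \<delta> powr \<mu>"
      using powr_add_le_add_powr[of \<delta> \<delta> \<mu>] \<mu> \<open>0 < \<delta>\<close> by simp
    finally have "M / \<mu> * (p\<^sub>2 - p\<^sub>1) powr \<mu> \<le> M / \<mu> * (2 * \<delta> powr \<mu>)"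
      using \<open>0 \<le> M\<close> \<mu> by (intro mult_left_mono) auto
    with trivial[of p\<^sub>1 p\<^sub>2] lt have "norm (integral {p\<^sub>1..p\<^sub>2} (\<lambda>p. F p * E p)) \<le> 2 / \<mu> * M * \<delta> powr \<mu>"
      by (simp add: mult_ac)
    also have "\<dots> \<le> (2 / \<mu> * M + (4 * M + V) * inverse m) * \<delta> powr \<mu>"
      using \<open>0 \<le> M\<close> \<open>0 \<le> V\<close> \<open>0 < m\<close> by (intro mult_right_mono) auto
    finally show ?thesis .
  next
    case True
    define a where "a = p\<^sub>1 + \<delta>"
    define b where "b = p\<^sub>2 - \<delta>"
    have ab: "p\<^sub>1 < a" "a < b" "b < p\<^sub>2"
      using True \<open>0 < \<delta>\<close> by (auto simp: a_def b_def)
    have "norm (integral {p\<^sub>1..a} (\<lambda>p. F p * E p)) \<le> M / \<mu> * \<delta> powr \<mu>"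
      using trivial[of p\<^sub>1 a] ab by (simp add: a_def)
    \<comment> \<open>Unlike the left piece, this one does not start at the singularity;
      subadditivity of the \<mu>-th power gives it the same bound.\<close>
    moreover have "norm (integral {b..p\<^sub>2} (\<lambda>p. F p * E p)) \<le> M / \<mu> * \<delta> powr \<mu>"
    proof -
      have "(p\<^sub>2 - p\<^sub>1) powr \<mu> - (b - p\<^sub>1) powr \<mu> \<le> \<delta> powr \<mu>"
        using powr_add_le_add_powr[of "b - p\<^sub>1" \<delta> \<mu>] ab \<mu> \<open>0 < \<delta>\<close> by (simp add: b_def)
      then have "M / \<mu> * ((p\<^sub>2 - p\<^sub>1) powr \<mu> - (b - p\<^sub>1) powr \<mu>) \<le> M / \<mu> * \<delta> powr \<mu>"
        using \<open>0 \<le> M\<close> \<mu> by (intro mult_left_mono) auto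
      with trivial[of b p\<^sub>2] ab show ?thesis by simp
    qed
    moreover have "norm (integral {a..b} (\<lambda>p. F p * E p)) \<le> (4 * M + V) * inverse m * \<delta> powr \<mu>"
    proof -
      define K where "K = m * \<delta> powr (\<rho> - 1)"
      define u' where "u' p = vector_derivative ut (at p)" for p
      define F' where "F' p = of_real ((p - p\<^sub>1) powr (\<mu> - 1)) * u' p
        + of_real ((\<mu> - 1) * (p - p\<^sub>1) powr (\<mu> - 2)) * ut p" for p
      \<comment> \<open>In the first summand the decreasing weight is replaced by its value at
        \<open>a\<close>. In the second it is kept, because
        \<open>(1 - \<mu>) * (p - p\<^sub>1) powr (\<mu> - 2)\<close> has the antiderivative
        \<open>- ((p - p\<^sub>1) powr (\<mu> - 1))\<close>.\<close>
      define h where "h p = \<delta> powr (\<mu> - 1) * norm (u' p) + M * ((1 - \<mu>) * (p - p\<^sub>1) powr (\<mu> - 2))" for p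
      have "0 < K"
        using \<open>0 < m\<close> \<open>0 < \<delta>\<close> by (simp add: K_def)
      have sub: "x \<in> {p\<^sub>1<..<p\<^sub>2}" "x \<in> {p\<^sub>1..p\<^sub>2}" "x \<in> I" if "x \<in> {a..b}" for x
        using that ab I_sub by auto
      have \<delta>_le: "(x - p\<^sub>1) powr (\<mu> - 1) \<le> \<delta> powr (\<mu> - 1)" if "x \<in> {a..b}" for x
        using that \<open>0 < \<delta>\<close> \<mu> by (intro powr_mono2') (auto simp: a_def)
      have powr': "((\<lambda>p. (p - p\<^sub>1) powr (\<mu> - 1)) has_real_derivative (\<mu> - 1) * (x - p\<^sub>1) powr (\<mu> - 2)) (at x)"
        if "x \<in> {a..b}" for x
        using sub(1)[OF that] by (auto intro!: derivative_eq_intros)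
      have F_der: "(F has_vector_derivative F' x) (at x)" if "x \<in> {a..b}" for x
      proof -
        have "(ut has_vector_derivative u' x) (at x)"
          unfolding u'_def using assms(14)[OF sub(1)[OF that]] by (simp add: vector_derivative_works)
        from has_vector_derivative_mult[OF has_vector_derivative_of_real[OF powr'[OF that]] this]
        show ?thesis
          unfolding F_def[abs_def] F'_def by simp
      qed
      have K_le: "K \<le> \<bar>deriv \<psi> x\<bar>" if "x \<in> {a..b}" for x
      proof -
        have "\<delta> powr (\<rho> - 1) \<le> \<bar>x - p\<^sub>0\<bar> powr (\<rho> - 1)"
          using that p0 \<rho> \<open>0 < \<delta>\<close> by (intro powr_mono2) (auto simp: a_def b_def)
        with m[OF sub(2)[OF that]] show ?thesis
          unfolding K_def \<psi>'[OF sub(3)[OF that]] abs_mult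
          using \<open>0 < m\<close> by (simp add: mult.commute[of m] mult_mono)
      qed
      have F_le: "norm (F x) \<le> M * \<delta> powr (\<mu> - 1)" if "x \<in> {a..b}" for x
        using nF[OF sub(2)[OF that]] mult_left_mono[OF \<delta>_le[OF that] \<open>0 \<le> M\<close>] by linarith
      have F'_le: "norm (F' x) \<le> h x" if "x \<in> {a..b}" for x
      proof -
        have "norm (F' x) \<le> (x - p\<^sub>1) powr (\<mu> - 1) * norm (u' x)
            + ((1 - \<mu>) * (x - p\<^sub>1) powr (\<mu> - 2)) * norm (ut x)"
          unfolding F'_def using \<mu> by (intro order_trans[OF norm_triangle_ineq]) (simp add: norm_mult abs_mult abs_of_nonpos del: of_real_diff of_real_mult)
        also have "\<dots> \<le> h x"
          unfolding h_def mult.commute[of M]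
          using \<mu> \<delta>_le[OF that] M[OF sub(2)[OF that]] by (intro add_mono mult_right_mono mult_left_mono) auto
        finally show ?thesis .
      qed
      have u'_abs: "u' absolutely_integrable_on {p\<^sub>1<..<p\<^sub>2}"
        unfolding u'_def using assms(15) .
      then have u'_int: "(\<lambda>p. norm (u' p)) integrable_on {p\<^sub>1<..<p\<^sub>2}"
        by (simp add: absolutely_integrable_on_def)
      have u'_int_ab: "(\<lambda>p. norm (u' p)) integrable_on {a..b}"
        using absolutely_integrable_on_subinterval[OF u'_abs subsetI[OF sub(1)]]
        by (simp add: absolutely_integrable_on_def)
      have "integral {a..b} (\<lambda>p. norm (u' p)) \<le> integral {p\<^sub>1<..<p\<^sub>2} (\<lambda>p. norm (u' p))"
        using sub(1) u'_int u'_int_ab by (intro integral_subset_le subsetI) auto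
      also have "\<dots> = V"
        unfolding V_def L1_norm_def u'_def[symmetric]
        by (rule set_lebesgue_integral_eq_integral(2)[symmetric]) (rule set_integrable_norm[OF u'_abs])
      finally have u'_V: "integral {a..b} (\<lambda>p. norm (u' p)) \<le> V" .
      have "((\<lambda>p. (1 - \<mu>) * (p - p\<^sub>1) powr (\<mu> - 2)) has_integral
          - ((b - p\<^sub>1) powr (\<mu> - 1)) - - ((a - p\<^sub>1) powr (\<mu> - 1))) {a..b}"
      proof (rule fundamental_theorem_of_calculus)
        fix x assume "x \<in> {a..b}"
        from DERIV_minus[OF powr'[OF this]]
        show "((\<lambda>p. - ((p - p\<^sub>1) powr (\<mu> - 1))) has_vector_derivative (1 - \<mu>) * (x - p\<^sub>1) powr (\<mu> - 2)) (at x within {a..b})"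
          by (simp add: has_real_derivative_iff_has_vector_derivative has_vector_derivative_at_within
              minus_mult_left)
      qed (use ab in auto)
      then have h_int: "(h has_integral \<delta> powr (\<mu> - 1) * integral {a..b} (\<lambda>p. norm (u' p))
          + M * (- ((b - p\<^sub>1) powr (\<mu> - 1)) - - ((a - p\<^sub>1) powr (\<mu> - 1)))) {a..b}"
        unfolding h_def
        by (intro has_integral_add has_integral_mult_right integrable_integral u'_int_ab)
      have "integral {a..b} h \<le> \<delta> powr (\<mu> - 1) * V + M * (\<delta> powr (\<mu> - 1) - (b - p\<^sub>1) powr (\<mu> - 1))"
        using h_int u'_V by (simp add: integral_unique a_def mult_left_mono)
      \<comment> \<open>At \<open>b\<close> the sharper bound is kept: it cancels the negative term
        in the integral of \<open>h\<close>. So \<open>F a\<close> contributes one \<open>M\<close>,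
        \<open>F b\<close> and \<open>h\<close> together one \<open>M\<close> and \<open>V\<close>,
        and the variation of \<open>1 / d\<close> two more, which is the factor
        \<open>4 * M + V\<close>.\<close>
      moreover have "norm (F a) \<le> M * \<delta> powr (\<mu> - 1)" "norm (F b) \<le> M * (b - p\<^sub>1) powr (\<mu> - 1)"
        using F_le[of a] nF[of b] ab by auto
      ultimately have num: "norm (F a) + norm (F b) + integral {a..b} h + 2 * (M * \<delta> powr (\<mu> - 1))
          \<le> (4 * M + V) * \<delta> powr (\<mu> - 1)"
        by (simp add: algebra_simps)
      have "norm (integral {a..b} (\<lambda>p. F p * E p))
          \<le> (norm (F a) + norm (F b) + integral {a..b} h + 2 * (M * \<delta> powr (\<mu> - 1))) / (\<omega> * K)"
        unfolding E_def
        using ab \<open>0 < K\<close> \<open>0 < \<omega>\<close> D1 D2 sub F_der K_le s F_le F'_le h_int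
        by (intro first_derivative_test[where d = "deriv \<psi>" and d' = D2 and F' = F' and s = s])
          (auto simp: has_integral_integrable)
      also have "\<dots> \<le> (4 * M + V) * \<delta> powr (\<mu> - 1) / (\<omega> * K)"
        using num \<open>0 < K\<close> \<open>0 < \<omega>\<close> by (intro divide_right_mono) auto
      also have "\<dots> = (4 * M + V) * inverse m * \<delta> powr \<mu>"
      proof -
        \<comment> \<open>Trading a factor \<delta> between the two powers isolates
          \<open>\<omega> * \<delta> powr \<rho>\<close>, which is 1.\<close>
        have "\<delta> powr \<mu> * (\<omega> * \<delta> powr (\<rho> - 1)) = \<delta> powr (\<mu> - 1) * (\<omega> * \<delta> powr \<rho>)"
          using \<open>0 < \<delta>\<close> by (simp add: powr_diff)
        then have eq: "\<delta> powr (\<mu> - 1) = \<delta> powr \<mu> * (\<omega> * \<delta> powr (\<rho> - 1))"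
          using \<omega>_\<delta> by simp
        show ?thesis
          unfolding eq K_def using \<open>0 < m\<close> \<open>0 < \<omega>\<close> \<open>0 < \<delta>\<close> by (simp add: field_simps)
      qed
      finally show ?thesis .
    qed
    moreover have "integral {p\<^sub>1..p\<^sub>2} (\<lambda>p. F p * E p) = integral {p\<^sub>1..a} (\<lambda>p. F p * E p)
        + integral {a..b} (\<lambda>p. F p * E p) + integral {b..p\<^sub>2} (\<lambda>p. F p * E p)"
      using ab FE_int
      by (simp add: Henstock_Kurzweil_Integration.integral_combine[of p\<^sub>1 a b]
          Henstock_Kurzweil_Integration.integral_combine[of p\<^sub>1 b p\<^sub>2])
    ultimately have "norm (integral {p\<^sub>1..p\<^sub>2} (\<lambda>p. F p * E p)) \<le> M / \<mu> * \<delta> powr \<mu>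
        + (4 * M + V) * inverse m * \<delta> powr \<mu> + M / \<mu> * \<delta> powr \<mu>"
      by (simp only:) (intro norm_triangle_mono)
    then show ?thesis
      by (simp add: algebra_simps)
  qed
  moreover have "(LINT p:{p\<^sub>1<..p\<^sub>2}|lebesgue. U p * exp (\<i> * of_real (\<omega> * \<psi> p)))
      = integral {p\<^sub>1..p\<^sub>2} (\<lambda>p. F p * E p)"
  proof -
    have "(LINT p:{p\<^sub>1<..p\<^sub>2}|lebesgue. U p * exp (\<i> * of_real (\<omega> * \<psi> p)))
        = (LINT p:{p\<^sub>1<..p\<^sub>2}|lebesgue. F p * E p)"
      using assms(17) by (intro set_lebesgue_integral_cong) (auto simp: F_def E_def)
    also have "\<dots> = integral {p\<^sub>1<..p\<^sub>2} (\<lambda>p. F p * E p)"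
      by (rule set_lebesgue_integral_eq_integral(2)) (rule set_integrable_subset[OF FE_abs], auto)
    also have "\<dots> = integral {p\<^sub>1..p\<^sub>2} (\<lambda>p. F p * E p)"
      by (rule integral_subset_negligible)
        (auto intro: negligible_subset[of "{p\<^sub>1}"])
    finally show ?thesis .
  qed
  ultimately show "norm (LINT p:{p\<^sub>1<..p\<^sub>2}|lebesgue. U p * exp (\<i> * of_real (\<omega> * \<psi> p)))
      \<le> C_tilde p\<^sub>1 p\<^sub>2 \<mu> ut \<psi>t * \<omega> powr (- (\<mu> / \<rho>))"
    by (simp add: C_tilde_def M_def V_def m_def \<delta>_\<mu>)
qed

end
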